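(* Let $\alpha\in(0,1)$. Assume that the subset pivotality condition is satisfied and that the local dependence structure of the p-values is given by batches $(B_b)_{b\in\mathbb N}$. For every $i\in\mathbb N$ let $\lambda_{b_i}\in[0,1)$ and $\alpha_i$ be measurable with respect to $\mathcal F_{b_i-1}=\sigma(\{P_j: b_j<b_i\})$, and put $C_i=\mathbf 1\{P_i\le\lambda_{b_i}\}$. Then every multiple testing procedure (rejecting $H_i$ if $P_i\le\alpha_i$) controls the familywise error rate in the strong sense at level $\alpha$ when the individual significance levels $(\alpha_i)_{i\in\mathbb N}$ satisfy $$\sum_{j=1}^{i}\frac{\alpha_j^{c}}{1-\lambda_{b_j}}(1-C_j)\le\alpha\qquad\text{for all } i\in\mathbb N,$$ where $$\alpha_j^{c}=\mathbb P_{H_{\mathbb N}}\left(\bigcap_{k\in B_{b_j},\,k<j,\,C_k=0}\{P_k>\alpha_k\}\cap\{P_j\le\alpha_j\}\ \Big|\ \mathcal F_{b_j-1}\right)$$ and $\mathbb P_{H_{\mathbb N}}$ indicates that the probability is calculated under the global null hypothesis.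
   Context: Setting: $(H_i)_{i\in\mathbb N}$ is a sequence of null hypotheses with p-values $(P_i)_{i\in\mathbb N}$ in $[0,1]$; $I_0\subseteq\mathbb N$ is the index set of true nulls; null p-values are valid: $\mathbb P(P_i\le x)\le x$ for $i\in I_0$, $x\in[0,1]$. Individual significance levels satisfy $\alpha_i\in[0,1)$. $\mathrm{FWER}=\mathbb P(\exists\,i\in I_0:P_i\le\alpha_i)$ under the true distribution $\mathbb P$; strong control at level $\alpha$ means $\mathrm{FWER}\le\alpha$ for every configuration of true and false null hypotheses. Batches: the p-values are divided into disjoint consecutive groups $B_1,B_2,\dots$ (identified with the corresponding sets of indices). P-values in the same batch may depend on each other, while p-values from different batches are independent. $b_i$ denotes the index of the batch containing $P_i$. The quantity $\lambda_b$ is common to all hypotheses in batch $b$. Subset pivotality: for every $I\subseteq\mathbb N$, the distribution of $(P_i)_{i\in I}$ under $H_I=\bigcap_{i\in I}H_i$ is the same as under the global null hypothesis $H_{\mathbb N}=\bigcap_{i\in\mathbb N}H_i$. *)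

theory Defs
  imports "HOL-Probability.Probability"
begin

text \<open>
  The statistical model is a set \<open>\<P>\<close> of probability measures on one sample space. The null
  hypothesis \<open>H i\<close> is the set of distributions for which it is true, so the configuration of true
  and false nulls is determined by the distribution in force. P-values, levels and the parameters
  \<open>\<lambda>\<close> are functions on the sample space and do not depend on that distribution. Hypotheses are
  numbered from 0.
\<close>

definition statistical_model :: "'a measure \<Rightarrow> 'a measure set \<Rightarrow> bool" where
  "statistical_model \<Omega> \<P> \<longleftrightarrow> (\<forall>M\<in>\<P>. prob_space M \<and> sets M = sets \<Omega>)"

definition true_nulls :: "(nat \<Rightarrow> 'a measure set) \<Rightarrow> 'a measure \<Rightarrow> nat set" where
  "true_nulls H M = {i. M \<in> H i}"

definition intersection_null ::
    "'a measure set \<Rightarrow> (nat \<Rightarrow> 'a measure set) \<Rightarrow> nat set \<Rightarrow> 'a measure set" where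
  "intersection_null \<P> H I = {M \<in> \<P>. \<forall>i\<in>I. M \<in> H i}"

definition valid_null_pvalues ::
    "'a measure set \<Rightarrow> (nat \<Rightarrow> 'a measure set) \<Rightarrow> (nat \<Rightarrow> 'a \<Rightarrow> real) \<Rightarrow> bool" where
  "valid_null_pvalues \<P> H P \<longleftrightarrow>
     (\<forall>M\<in>\<P>. \<forall>i\<in>true_nulls H M. \<forall>x\<in>{0..1}. measure M {\<omega> \<in> space M. P i \<omega> \<le> x} \<le> x)"

definition pvalue_law ::
    "'a measure \<Rightarrow> (nat \<Rightarrow> 'a \<Rightarrow> real) \<Rightarrow> nat set \<Rightarrow> (nat \<Rightarrow> real) measure" where
  "pvalue_law M P I = distr M (\<Pi>\<^sub>M i\<in>I. borel) (\<lambda>\<omega>. \<lambda>i\<in>I. P i \<omega>)"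

definition subset_pivotality ::
    "'a measure set \<Rightarrow> (nat \<Rightarrow> 'a measure set) \<Rightarrow> (nat \<Rightarrow> 'a \<Rightarrow> real) \<Rightarrow> bool" where
  "subset_pivotality \<P> H P \<longleftrightarrow>
     (\<forall>I. \<forall>M \<in> intersection_null \<P> H I. \<forall>M\<^sub>0 \<in> intersection_null \<P> H UNIV.
        pvalue_law M P I = pvalue_law M\<^sub>0 P I)"

text \<open>
  A division into batches is given by the map \<open>b\<close> from an index to the number of its batch; the
  batch \<open>B\<^sub>n\<close> is \<open>b -` {n}\<close>. Monotonicity makes the batches consecutive and surjectivity makes all
  of them nonempty (hence finite).
\<close>

definition batching :: "(nat \<Rightarrow> nat) \<Rightarrow> bool" where
  "batching b \<longleftrightarrow> mono b \<and> surj b"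

definition batchwise_independent ::
    "'a measure \<Rightarrow> (nat \<Rightarrow> nat) \<Rightarrow> (nat \<Rightarrow> 'a \<Rightarrow> real) \<Rightarrow> bool" where
  "batchwise_independent M b P \<longleftrightarrow>
     prob_space.indep_vars M (\<lambda>n. \<Pi>\<^sub>M i\<in>b -` {n}. borel) (\<lambda>n \<omega>. \<lambda>i\<in>b -` {n}. P i \<omega>) UNIV"

text \<open>\<open>past \<Omega> b P n\<close> is the sigma-algebra \<open>\<F>\<^bsub>n-1\<^esub>\<close> generated by the batches before batch \<open>n\<close>.\<close>

definition past :: "'a measure \<Rightarrow> (nat \<Rightarrow> nat) \<Rightarrow> (nat \<Rightarrow> 'a \<Rightarrow> real) \<Rightarrow> nat \<Rightarrow> 'a measure" where
  "past \<Omega> b P n =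
     sigma (space \<Omega>) (\<Union>j\<in>{j. b j < n}. {P j -` A \<inter> space \<Omega> | A. A \<in> sets borel})"

definition C_ind ::
    "(nat \<Rightarrow> nat) \<Rightarrow> (nat \<Rightarrow> 'a \<Rightarrow> real) \<Rightarrow> (nat \<Rightarrow> 'a \<Rightarrow> real) \<Rightarrow> nat \<Rightarrow> 'a \<Rightarrow> real" where
  "C_ind b P lam i \<omega> = of_bool (P i \<omega> \<le> lam (b i) \<omega>)"

text \<open>
  \<open>cond_prob_past M\<^sub>0 P lev K j\<close> is the conditional probability under \<open>M\<^sub>0\<close>, given the batches before
  that of \<open>j\<close>, of the event that \<open>P k > lev k\<close> for all \<open>k \<in> K\<close> and \<open>P j \<le> lev j\<close>, where \<open>K\<close> lies in the
  batch of \<open>j\<close>. The levels depend on the past only and the batch is independent of it, so the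
  conditional probability is obtained by freezing the levels at the observed past \<open>\<omega>\<close> and drawing
  the batch afresh from \<open>M\<^sub>0\<close>. Lemma \<open>cond_prob_past_eq_real_cond_exp\<close> below shows that this is a
  version of the conditional expectation. A version has to be fixed pointwise, since it is used
  also under distributions that are not absolutely continuous with respect to \<open>M\<^sub>0\<close>.
\<close>

definition cond_prob_past ::
    "'a measure \<Rightarrow> (nat \<Rightarrow> 'a \<Rightarrow> real) \<Rightarrow> (nat \<Rightarrow> 'a \<Rightarrow> real) \<Rightarrow> nat set \<Rightarrow> nat \<Rightarrow> 'a \<Rightarrow> real" where
  "cond_prob_past M\<^sub>0 P lev K j \<omega> =
     measure M\<^sub>0 {\<omega>' \<in> space M\<^sub>0. (\<forall>k\<in>K. lev k \<omega> < P k \<omega>') \<and> P j \<omega>' \<le> lev j \<omega>}"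

text \<open>
  In \<open>\<alpha>\<^sub>j\<^sup>c\<close> the set of indices over which the intersection runs is the observed one. It is a
  parameter of the event whose conditional probability is taken, and is not averaged over.
\<close>

definition alpha_c ::
    "'a measure \<Rightarrow> (nat \<Rightarrow> nat) \<Rightarrow> (nat \<Rightarrow> 'a \<Rightarrow> real) \<Rightarrow> (nat \<Rightarrow> 'a \<Rightarrow> real) \<Rightarrow> (nat \<Rightarrow> 'a \<Rightarrow> real)
       \<Rightarrow> nat \<Rightarrow> 'a \<Rightarrow> real" where
  "alpha_c M\<^sub>0 b P lam lev j \<omega> =
     cond_prob_past M\<^sub>0 P lev {k. b k = b j \<and> k < j \<and> C_ind b P lam k \<omega> = 0} j \<omega>"

definition fwer ::
    "(nat \<Rightarrow> 'a measure set) \<Rightarrow> (nat \<Rightarrow> 'a \<Rightarrow> real) \<Rightarrow> (nat \<Rightarrow> 'a \<Rightarrow> real) \<Rightarrow> 'a measure \<Rightarrow> real" where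
  "fwer H P lev M = measure M {\<omega> \<in> space M. \<exists>i\<in>true_nulls H M. P i \<omega> \<le> lev i \<omega>}"

definition strong_fwer_control ::
    "'a measure set \<Rightarrow> (nat \<Rightarrow> 'a measure set) \<Rightarrow> (nat \<Rightarrow> 'a \<Rightarrow> real) \<Rightarrow> (nat \<Rightarrow> 'a \<Rightarrow> real)
       \<Rightarrow> real \<Rightarrow> bool" where
  "strong_fwer_control \<P> H P lev \<alpha> \<longleftrightarrow> (\<forall>M\<in>\<P>. fwer H P lev M \<le> \<alpha>)"

lemma space_past [simp]: "space (past \<Omega> b P n) = space \<Omega>"
  unfolding past_def by (rule space_measure_of) auto

lemma sets_past:
  "sets (past \<Omega> b P n) =
     sigma_sets (space \<Omega>) (\<Union>j\<in>{j. b j < n}. {P j -` A \<inter> space \<Omega> | A. A \<in> sets borel})"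
  unfolding past_def by (rule sets_measure_of) auto

lemma subalgebra_past:
  assumes "\<And>i. P i \<in> borel_measurable M"
  shows "subalgebra M (past M b P n)"
proof -
  have "(\<Union>j\<in>{j. b j < n}. {P j -` A \<inter> space M | A. A \<in> sets borel}) \<subseteq> sets M"
    using assms by (auto intro: measurable_sets)
  then show ?thesis
    unfolding subalgebra_def sets_past by (simp add: sets.sigma_sets_subset)
qed

lemma indep_past_batch:
  assumes M: "prob_space M"
    and P: "\<And>i. P i \<in> borel_measurable M"
    and ind: "batchwise_independent M b P"
  shows "prob_space.indep_set M (sets (past M b P n))
           {(\<lambda>\<omega>. \<lambda>i\<in>b -` {n}. P i \<omega>) -` A \<inter> space M | A. A \<in> sets (\<Pi>\<^sub>M i\<in>b -` {n}. borel)}"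
proof -
  interpret prob_space M by fact
  define T where "T = (\<lambda>m. \<Pi>\<^sub>M i\<in>b -` {m}. (borel :: real measure))"
  define Y where "Y = (\<lambda>m \<omega>. \<lambda>i\<in>b -` {m}. P i \<omega>)"
  define E where "E = (\<lambda>m. {Y m -` A \<inter> space M | A. A \<in> sets (T m)})"
  define I where "I = (\<lambda>x. if x then {..<n} else {n})"
  have Y[measurable]: "Y m \<in> measurable M (T m)" for m
    unfolding Y_def T_def using P by measurable
  have E: "indep_sets E UNIV"
    using ind unfolding batchwise_independent_def indep_vars_def2 E_def T_def Y_def by simp
  have Int: "Int_stable (E m)" for m
    unfolding E_def Int_stable_def
    by (auto, rule_tac x="A \<inter> Aa" in exI, auto)
  have "indep_sets (\<lambda>x. sigma_sets (space M) (\<Union>i\<in>I x. E i)) UNIV"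
    by (rule indep_sets_collect_sigma)
       (auto simp: disjoint_family_on_def I_def Int intro: indep_sets_mono_index[OF _ E])
  then have 1: "indep_set (sigma_sets (space M) (\<Union>i\<in>{..<n}. E i)) (sigma_sets (space M) (E n))"
    unfolding indep_set_def by (rule indep_sets_mono_sets) (auto simp: I_def split: bool.split)
  have gen: "P j -` A \<inter> space M \<in> E (b j)" if "A \<in> sets borel" for j A
  proof -
    have "(\<lambda>y. y j) -` A \<inter> space (T (b j)) \<in> sets (T (b j))"
      unfolding T_def using that by measurable
    moreover have "P j -` A \<inter> space M = Y (b j) -` ((\<lambda>y. y j) -` A \<inter> space (T (b j))) \<inter> space M"
      using measurable_space[OF Y] by (auto simp: Y_def)
    ultimately show ?thesis unfolding E_def by blast
  qed
  have "sets (past M b P n) \<subseteq> sigma_sets (space M) (\<Union>i\<in>{..<n}. E i)"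
    unfolding sets_past by (rule sigma_sets_mono') (use gen in blast)
  moreover have "E n \<subseteq> sigma_sets (space M) (E n)" by (rule sigma_sets_superset_generator)
  ultimately have "indep_set (sets (past M b P n)) (E n)"
    using 1 unfolding indep_sets2_eq by blast
  then show ?thesis unfolding E_def Y_def T_def .
qed

lemma cond_prob_past_eq_real_cond_exp:
  assumes M: "prob_space M\<^sub>0"
    and P: "\<And>i. P i \<in> borel_measurable M\<^sub>0"
    and ind: "batchwise_independent M\<^sub>0 b P"
    and lev: "\<And>i. lev i \<in> borel_measurable (past M\<^sub>0 b P (b i))"
    and K: "K \<subseteq> b -` {b j}"
  shows "AE \<omega> in M\<^sub>0.
     real_cond_exp M\<^sub>0 (past M\<^sub>0 b P (b j))
       (indicator {\<omega> \<in> space M\<^sub>0. (\<forall>k\<in>K. lev k \<omega> < P k \<omega>) \<and> P j \<omega> \<le> lev j \<omega>}) \<omega>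
     = cond_prob_past M\<^sub>0 P lev K j \<omega>"
proof -
  interpret prob_space M\<^sub>0 by fact
  define F where "F = past M\<^sub>0 b P (b j)"
  define B where "B = b -` {b j}"
  define T where "T = (\<Pi>\<^sub>M i\<in>B. (borel :: real measure))"
  define Y where "Y = (\<lambda>\<omega>. \<lambda>i\<in>B. P i \<omega>)"
  define D where "D = {z \<in> space (F \<Otimes>\<^sub>M T). (\<forall>k\<in>K. lev k (fst z) < snd z k) \<and> snd z j \<le> lev j (fst z)}"
  define E where "E = {\<omega> \<in> space M\<^sub>0. (\<forall>k\<in>K. lev k \<omega> < P k \<omega>) \<and> P j \<omega> \<le> lev j \<omega>}"
  have sub: "subalgebra M\<^sub>0 F" unfolding F_def by (rule subalgebra_past[OF P])
  interpret sigma_finite_subalgebra M\<^sub>0 F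
    using sub by (intro finite_measure_subalgebra_is_sigma_finite)
       (simp add: finite_measure_subalgebra_def finite_measure_subalgebra_axioms_def finite_measure_axioms)
  have spF: "space F = space M\<^sub>0" unfolding F_def by simp
  have iv: "indep_set (sets F) {Y -` A \<inter> space M\<^sub>0 | A. A \<in> sets T}"
    using indep_past_batch[OF M P ind] unfolding F_def T_def Y_def B_def .
  have rv: "(\<lambda>\<omega>. \<omega>) \<in> measurable M\<^sub>0 F" "Y \<in> measurable M\<^sub>0 T"
    by (rule measurable_from_subalg[OF sub measurable_ident_sets[OF refl]])
       (simp add: T_def Y_def measurable_restrict P)
  note [measurable] = rv
  have jB: "j \<in> B" and KB: "K \<subseteq> B" using K unfolding B_def by auto
  have cK: "countable K" by (rule countableI_type)
  have levF[measurable]: "lev k \<in> borel_measurable F" if "k \<in> B" for k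
    using lev[of k] that unfolding F_def B_def by simp
  have comp[measurable]: "(\<lambda>y. y k) \<in> borel_measurable T" if "k \<in> B" for k
    unfolding T_def using that by measurable
  have D: "D \<in> sets (F \<Otimes>\<^sub>M T)"
  proof -
    have "Measurable.pred (F \<Otimes>\<^sub>M T) (\<lambda>z. lev k (fst z) < snd z k)" if "k \<in> B" for k
      using measurable_compose[OF measurable_fst levF[OF that], of T]
        measurable_compose[OF measurable_snd comp[OF that], of F] by measurable
    moreover have "Measurable.pred (F \<Otimes>\<^sub>M T) (\<lambda>z. snd z j \<le> lev j (fst z))"
      using measurable_compose[OF measurable_fst levF[OF jB], of T]
        measurable_compose[OF measurable_snd comp[OF jB], of F] by measurable
    ultimately have "Measurable.pred (F \<Otimes>\<^sub>M T)
        (\<lambda>z. (\<forall>k\<in>K. lev k (fst z) < snd z k) \<and> snd z j \<le> lev j (fst z))"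
      using KB by (intro pred_intros_logic pred_intros_countable_bounded cK) auto
    then show ?thesis unfolding D_def by (rule predE)
  qed
  have YT: "Y \<omega> \<in> space T" if "\<omega> \<in> space M\<^sub>0" for \<omega>
    using measurable_space[OF rv(2) that] .
  have Dmem: "(\<omega>, Y \<omega>') \<in> D \<longleftrightarrow> (\<forall>k\<in>K. lev k \<omega> < P k \<omega>') \<and> P j \<omega>' \<le> lev j \<omega>"
    if "\<omega> \<in> space M\<^sub>0" "\<omega>' \<in> space M\<^sub>0" for \<omega> \<omega>'
    using that YT[OF that(2)] KB jB unfolding D_def
    by (auto simp: space_pair_measure spF Y_def subset_iff)
  interpret Q: prob_space "distr M\<^sub>0 T Y" by (rule prob_space_distr) (rule rv)
  interpret R: prob_space "distr M\<^sub>0 F (\<lambda>\<omega>. \<omega>)" by (rule prob_space_distr) (rule rv)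
  have prod: "distr M\<^sub>0 F (\<lambda>\<omega>. \<omega>) \<Otimes>\<^sub>M distr M\<^sub>0 T Y = distr M\<^sub>0 (F \<Otimes>\<^sub>M T) (\<lambda>\<omega>. (\<omega>, Y \<omega>))"
  proof (rule pair_measure_eqI)
    show "sigma_finite_measure (distr M\<^sub>0 F (\<lambda>\<omega>. \<omega>))" "sigma_finite_measure (distr M\<^sub>0 T Y)"
      by unfold_locales
    show "sets (distr M\<^sub>0 F (\<lambda>\<omega>. \<omega>) \<Otimes>\<^sub>M distr M\<^sub>0 T Y)
        = sets (distr M\<^sub>0 (F \<Otimes>\<^sub>M T) (\<lambda>\<omega>. (\<omega>, Y \<omega>)))"
      by (simp cong: sets_pair_measure_cong)
  next
    fix A A' assume "A \<in> sets (distr M\<^sub>0 F (\<lambda>\<omega>. \<omega>))" "A' \<in> sets (distr M\<^sub>0 T Y)"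
    then have A: "A \<in> sets F" and A': "A' \<in> sets T" by simp_all
    have A0: "A \<subseteq> space M\<^sub>0" using sets.sets_into_space[OF A] by (simp add: spF)
    have "prob (A \<inter> (Y -` A' \<inter> space M\<^sub>0)) = prob A * prob (Y -` A' \<inter> space M\<^sub>0)"
      using iv A A' unfolding indep_sets2_eq by blast
    moreover have "(\<lambda>\<omega>. (\<omega>, Y \<omega>)) -` (A \<times> A') \<inter> space M\<^sub>0 = A \<inter> (Y -` A' \<inter> space M\<^sub>0)"
      using A0 by auto
    moreover have "(\<lambda>\<omega>. \<omega>) -` A \<inter> space M\<^sub>0 = A" using A0 by auto
    ultimately show "emeasure (distr M\<^sub>0 F (\<lambda>\<omega>. \<omega>)) A * emeasure (distr M\<^sub>0 T Y) A'
        = emeasure (distr M\<^sub>0 (F \<Otimes>\<^sub>M T) (\<lambda>\<omega>. (\<omega>, Y \<omega>))) (A \<times> A')"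
      using A A' by (simp add: emeasure_distr emeasure_eq_measure ennreal_mult'')
  qed
  have g: "cond_prob_past M\<^sub>0 P lev K j \<omega> = measure (distr M\<^sub>0 T Y) (Pair \<omega> -` D)"
    if "\<omega> \<in> space M\<^sub>0" for \<omega>
  proof -
    have "Pair \<omega> -` D \<in> sets T" using D by (rule sets_Pair1)
    then have "measure (distr M\<^sub>0 T Y) (Pair \<omega> -` D) = measure M\<^sub>0 (Y -` (Pair \<omega> -` D) \<inter> space M\<^sub>0)"
      by (intro measure_distr) (rule rv)
    also have "Y -` (Pair \<omega> -` D) \<inter> space M\<^sub>0 =
        {\<omega>' \<in> space M\<^sub>0. (\<forall>k\<in>K. lev k \<omega> < P k \<omega>') \<and> P j \<omega>' \<le> lev j \<omega>}"
      using Dmem[OF that] by auto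
    finally show ?thesis unfolding cond_prob_past_def by simp
  qed
  have gm: "(\<lambda>\<omega>. measure (distr M\<^sub>0 T Y) (Pair \<omega> -` D)) \<in> borel_measurable F"
  proof -
    have "D \<in> sets (F \<Otimes>\<^sub>M distr M\<^sub>0 T Y)" using D by (simp cong: sets_pair_measure_cong)
    then show ?thesis
      unfolding measure_def by (intro borel_measurable_enn2real Q.measurable_emeasure_Pair)
  qed
  have gm': "cond_prob_past M\<^sub>0 P lev K j \<in> borel_measurable F"
    using gm by (rule measurable_cong[THEN iffD2, rotated]) (simp add: g spF)
  have E: "E \<in> sets M\<^sub>0"
  proof -
    have "(\<lambda>\<omega>. (\<omega>, Y \<omega>)) -` D \<inter> space M\<^sub>0 \<in> sets M\<^sub>0"
      using D by (intro measurable_sets[of _ _ "F \<Otimes>\<^sub>M T"]) simp_all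
    also have "(\<lambda>\<omega>. (\<omega>, Y \<omega>)) -` D \<inter> space M\<^sub>0 = E" using Dmem unfolding E_def by auto
    finally show ?thesis .
  qed
  have "AE \<omega> in M\<^sub>0. real_cond_exp M\<^sub>0 F (indicator E) \<omega> = cond_prob_past M\<^sub>0 P lev K j \<omega>"
  proof (rule real_cond_exp_charact)
    show "integrable M\<^sub>0 (indicator E :: _ \<Rightarrow> real)" using E by (simp add: emeasure_eq_measure)
    show "cond_prob_past M\<^sub>0 P lev K j \<in> borel_measurable F" by (rule gm')
    show int: "integrable M\<^sub>0 (cond_prob_past M\<^sub>0 P lev K j)"
      using measurable_from_subalg[OF sub gm']
      by (intro integrable_const_bound[where B=1]) (auto simp: cond_prob_past_def)
    fix A assume A: "A \<in> sets F"
    then have AM: "A \<in> sets M\<^sub>0" using sub unfolding subalgebra_def by auto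
    have AD: "(A \<times> space T) \<inter> D \<in> sets (F \<Otimes>\<^sub>M T)" using A D by auto
    have "(\<integral>\<omega>\<in>A. indicator E \<omega> \<partial>M\<^sub>0) = measure M\<^sub>0 (A \<inter> E)"
      using A AM E by (simp add: set_lebesgue_integral_def indicator_inter_arith[symmetric])
    also have "A \<inter> E = (\<lambda>\<omega>. (\<omega>, Y \<omega>)) -` ((A \<times> space T) \<inter> D) \<inter> space M\<^sub>0"
      using Dmem YT unfolding E_def by auto
    also have "measure M\<^sub>0 \<dots> = measure (distr M\<^sub>0 (F \<Otimes>\<^sub>M T) (\<lambda>\<omega>. (\<omega>, Y \<omega>))) ((A \<times> space T) \<inter> D)"
      using AD by (intro measure_distr[symmetric]) simp_all
    also have "\<dots> = measure (distr M\<^sub>0 F (\<lambda>\<omega>. \<omega>) \<Otimes>\<^sub>M distr M\<^sub>0 T Y) ((A \<times> space T) \<inter> D)"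
      unfolding prod ..
    also have "\<dots> = (\<integral>\<omega>. measure (distr M\<^sub>0 T Y) (Pair \<omega> -` ((A \<times> space T) \<inter> D))
        \<partial>distr M\<^sub>0 F (\<lambda>\<omega>. \<omega>))"
    proof -
      let ?h = "\<lambda>\<omega>. measure (distr M\<^sub>0 T Y) (Pair \<omega> -` ((A \<times> space T) \<inter> D))"
      have X: "(A \<times> space T) \<inter> D \<in> sets (distr M\<^sub>0 F (\<lambda>\<omega>. \<omega>) \<Otimes>\<^sub>M distr M\<^sub>0 T Y)"
        using AD by (simp cong: sets_pair_measure_cong)
      have hm: "?h \<in> borel_measurable (distr M\<^sub>0 F (\<lambda>\<omega>. \<omega>))"
        unfolding measure_def by (intro borel_measurable_enn2real Q.measurable_emeasure_Pair X)
      have "emeasure (distr M\<^sub>0 F (\<lambda>\<omega>. \<omega>) \<Otimes>\<^sub>M distr M\<^sub>0 T Y) ((A \<times> space T) \<inter> D)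
          = (\<integral>\<^sup>+\<omega>. ennreal (?h \<omega>) \<partial>distr M\<^sub>0 F (\<lambda>\<omega>. \<omega>))"
        using Q.emeasure_pair_measure_alt[OF X] by (simp add: Q.emeasure_eq_measure)
      then show ?thesis
        unfolding integral_eq_nn_integral[OF hm AE_I2[OF measure_nonneg]] measure_def[of "_ \<Otimes>\<^sub>M _"]
        by simp
    qed
    also have "\<dots> = (\<integral>\<omega>. indicator A \<omega> * measure (distr M\<^sub>0 T Y) (Pair \<omega> -` D) \<partial>distr M\<^sub>0 F (\<lambda>\<omega>. \<omega>))"
    proof (rule Bochner_Integration.integral_cong[OF refl])
      fix \<omega>
      have "Pair \<omega> -` ((A \<times> space T) \<inter> D) = (if \<omega> \<in> A then Pair \<omega> -` D else {})"
        using sets.sets_into_space[OF D] by (auto simp: space_pair_measure)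
      then show "measure (distr M\<^sub>0 T Y) (Pair \<omega> -` ((A \<times> space T) \<inter> D)) =
          indicator A \<omega> * measure (distr M\<^sub>0 T Y) (Pair \<omega> -` D)" by simp
    qed
    also have "\<dots> = (\<integral>\<omega>. indicator A \<omega> * measure (distr M\<^sub>0 T Y) (Pair \<omega> -` D) \<partial>M\<^sub>0)"
      using A gm by (intro integral_distr rv) simp_all
    also have "\<dots> = (\<integral>\<omega>\<in>A. cond_prob_past M\<^sub>0 P lev K j \<omega> \<partial>M\<^sub>0)"
      unfolding set_lebesgue_integral_def
      by (intro Bochner_Integration.integral_cong refl) (simp add: g)
    finally show "(\<integral>\<omega>\<in>A. indicator E \<omega> \<partial>M\<^sub>0) = (\<integral>\<omega>\<in>A. cond_prob_past M\<^sub>0 P lev K j \<omega> \<partial>M\<^sub>0)" .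
  qed
  then show ?thesis unfolding E_def F_def .
qed

end

theory Submission
  imports Defs
begin

text \<open>
  Within a batch, with the past frozen, the terms \<open>\<alpha>\<^sub>j\<^sup>c\<close> with \<open>C\<^sub>j = 0\<close> are the probabilities under
  \<open>M\<^sub>0\<close> that \<open>j\<close> is the first rejection among the indices \<open>S\<close> with \<open>C = 0\<close>, so they add up to the
  probability of some rejection in \<open>S\<close>. This is at least the sum, over the true nulls \<open>j \<in> S\<close>, of the
  probability \<open>p\<^sub>j\<close> that \<open>j\<close> is the first rejection among all true nulls of the batch. Now the
  index set is deterministic, pivotality allows \<open>p\<^sub>j\<close> to be computed under the true distribution, and
  the independent factor \<open>1 - C\<^sub>j\<close> has conditional mean at least \<open>1 - \<lambda>\<close>. Hence
  \<open>p\<^sub>j (1 - C\<^sub>j) / (1 - \<lambda>)\<close> has mean at least the probability that \<open>j\<close> is the first false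
  rejection of its batch, and summing over \<open>j\<close> bounds the familywise error rate by the budget.
\<close>

section \<open>First occurrences in a sequence of events\<close>

lemma (in finite_measure) sum_measure_first_le_measure_Union:
  fixes E :: "nat \<Rightarrow> 'a set"
  assumes "finite D" "D \<subseteq> T" and E: "\<And>k. E k \<in> sets M"
  shows "(\<Sum>j\<in>D. measure M (E j - (\<Union>k\<in>{k\<in>T. k < j}. E k))) \<le> measure M (\<Union>j\<in>D. E j)"
proof -
  let ?A = "\<lambda>j. E j - (\<Union>k\<in>{k\<in>T. k < j}. E k)"
  have A: "?A ` D \<subseteq> sets M" using E by auto
  \<comment> \<open>Of two distinct indices in \<open>D\<close>, the smaller one lies in
    \<open>T\<close>, so its event is removed from the piece of the larger one.\<close>
  have "disjoint_family_on ?A D"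
    unfolding disjoint_family_on_def
  proof (intro ballI impI)
    fix i j assume "i \<in> D" "j \<in> D" "i \<noteq> j"
    with assms(2) show "?A i \<inter> ?A j = {}" by (cases i j rule: linorder_cases) auto
  qed
  then have "(\<Sum>j\<in>D. measure M (?A j)) = measure M (\<Union>j\<in>D. ?A j)"
    using finite_measure_finite_Union[OF assms(1) A] by simp
  also have "\<dots> \<le> measure M (\<Union>j\<in>D. E j)"
    using E assms(1) by (intro finite_measure_mono) auto
  finally show ?thesis .
qed

lemma UN_first_eq:
  fixes E :: "nat \<Rightarrow> 'a set"
  shows "(\<Union>j\<in>S. E j - (\<Union>k\<in>{k\<in>S. k < j}. E k)) = (\<Union>j\<in>S. E j)"
proof (intro equalityI subsetI)
  fix x assume "x \<in> (\<Union>j\<in>S. E j)"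
  then have ex: "\<exists>j. j \<in> S \<and> x \<in> E j" by auto
  define j where "j = (LEAST j. j \<in> S \<and> x \<in> E j)"
  have "j \<in> S \<and> x \<in> E j" unfolding j_def using ex by (rule LeastI_ex)
  moreover have "\<not> (k \<in> S \<and> x \<in> E k)" if "k < j" for k
    using not_less_Least that unfolding j_def by blast
  ultimately show "x \<in> (\<Union>j\<in>S. E j - (\<Union>k\<in>{k\<in>S. k < j}. E k))" by auto
qed auto

text \<open>For a single \<open>j\<close> neither summand need dominate the other, because different
  earlier events are removed. The comparison goes through unions: the pieces on the left are
  disjoint inside the union over \<open>D\<close>, and the pieces on the right cover the union over
  \<open>S\<close>. Later \<open>S\<close> is the observed set with \<open>C = 0\<close> and
  \<open>T\<close> the true nulls of a batch.\<close>

lemma (in finite_measure) sum_measure_first_mono: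
  fixes E :: "nat \<Rightarrow> 'a set"
  assumes S: "finite S" and E: "\<And>k. E k \<in> sets M" and "D \<subseteq> S" "D \<subseteq> T"
  shows "(\<Sum>j\<in>D. measure M (E j - (\<Union>k\<in>{k\<in>T. k < j}. E k)))
    \<le> (\<Sum>j\<in>S. measure M (E j - (\<Union>k\<in>{k\<in>S. k < j}. E k)))"
proof -
  have "finite D" using assms(3) S by (rule finite_subset)
  then have "(\<Sum>j\<in>D. measure M (E j - (\<Union>k\<in>{k\<in>T. k < j}. E k))) \<le> measure M (\<Union>j\<in>D. E j)"
    using assms(4) E by (rule sum_measure_first_le_measure_Union)
  also have "\<dots> \<le> measure M (\<Union>j\<in>S. E j)"
    using E S assms(3) by (intro finite_measure_mono) auto
  also have "\<dots> = measure M (\<Union>j\<in>S. E j - (\<Union>k\<in>{k\<in>S. k < j}. E k))"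
    by (simp only: UN_first_eq)
  also have "\<dots> \<le> (\<Sum>j\<in>S. measure M (E j - (\<Union>k\<in>{k\<in>S. k < j}. E k)))"
    using S E by (intro finite_measure_subadditive_finite) auto
  finally show ?thesis .
qed

section \<open>First-rejection probabilities with frozen levels\<close>

lemma cond_prob_past_eq_measure_first:
  "cond_prob_past M P lev {k\<in>T. k < j} j \<omega> =
    measure M ({\<omega>' \<in> space M. P j \<omega>' \<le> lev j \<omega>} -
      (\<Union>k\<in>{k\<in>T. k < j}. {\<omega>' \<in> space M. P k \<omega>' \<le> lev k \<omega>}))"
  unfolding cond_prob_past_def by (rule arg_cong[where f="measure M"]) (auto simp: not_le)

lemma cond_prob_past_nonneg: "0 \<le> cond_prob_past M P lev K j \<omega>"
  unfolding cond_prob_past_def by simp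

text \<open>Once the levels are frozen at \<open>\<omega>\<close> they are constants, and the event
  constrains only p-values with index in \<open>I\<close>. Its probability is therefore the mass of
  one fixed set under the joint law. This is how pivotality enters, and why first rejections are
  taken among true nulls only.\<close>

lemma pvalue_law_eq_imp_cond_prob_past_eq:
  assumes law: "pvalue_law M P I = pvalue_law N P I"
    and M: "\<And>i. P i \<in> borel_measurable M" and N: "\<And>i. P i \<in> borel_measurable N"
    and K: "insert j K \<subseteq> I"
  shows "cond_prob_past M P lev K j \<omega> = cond_prob_past N P lev K j \<omega>"
proof -
  let ?T = "\<Pi>\<^sub>M i\<in>I. (borel :: real measure)"
  define D where "D = {y \<in> space ?T. (\<forall>k\<in>K. lev k \<omega> < y k) \<and> y j \<le> lev j \<omega>}"
  have comp[measurable]: "(\<lambda>y. y k) \<in> borel_measurable ?T" if "k \<in> I" for k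
    using that by measurable
  have "Measurable.pred ?T (\<lambda>y. (\<forall>k\<in>K. lev k \<omega> < y k) \<and> y j \<le> lev j \<omega>)"
    using K by (intro pred_intros_logic pred_intros_countable_bounded countableI_type) auto
  then have D: "D \<in> sets ?T" unfolding D_def by (rule predE)
  have eq: "cond_prob_past L P lev K j \<omega> = measure (pvalue_law L P I) D"
    if L[measurable]: "\<And>i. P i \<in> borel_measurable L" for L
  proof -
    have "(\<lambda>\<omega>'. \<lambda>i\<in>I. P i \<omega>') \<in> measurable L ?T" by measurable
    then have "measure (pvalue_law L P I) D = measure L ((\<lambda>\<omega>'. \<lambda>i\<in>I. P i \<omega>') -` D \<inter> space L)"
      unfolding pvalue_law_def using D by (rule measure_distr)
    also have "(\<lambda>\<omega>'. \<lambda>i\<in>I. P i \<omega>') -` D \<inter> space L =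
        {\<omega>' \<in> space L. (\<forall>k\<in>K. lev k \<omega> < P k \<omega>') \<and> P j \<omega>' \<le> lev j \<omega>}"
      using K unfolding D_def by (auto simp: space_PiM subset_iff)
    finally show ?thesis unfolding cond_prob_past_def by simp
  qed
  show ?thesis using eq[OF M] eq[OF N] law by simp
qed

text \<open>The comparison is made at a fixed \<open>\<omega>\<close>, batch by batch. There the
  observed index set is an ordinary set, and both sides are sums of first-rejection probabilities
  under the same measure, so \<open>sum_measure_first_mono\<close> applies.\<close>

lemma sum_cond_prob_past_le_sum_alpha_c:
  assumes "prob_space M\<^sub>0" and P[measurable]: "\<And>i. P i \<in> borel_measurable M\<^sub>0"
    and lam: "\<And>i. lam (b i) \<omega> < 1"
  shows "(\<Sum>j\<in>{j. j \<le> i \<and> j \<in> I}.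
        cond_prob_past M\<^sub>0 P lev {k\<in>{k. b k = b j \<and> k \<in> I}. k < j} j \<omega> / (1 - lam (b j) \<omega>)
          * (1 - C_ind b P lam j \<omega>))
    \<le> (\<Sum>j\<le>i. alpha_c M\<^sub>0 b P lam lev j \<omega> / (1 - lam (b j) \<omega>) * (1 - C_ind b P lam j \<omega>))"
proof -
  interpret prob_space M\<^sub>0 by fact
  define E where "E = (\<lambda>k. {\<omega>' \<in> space M\<^sub>0. P k \<omega>' \<le> lev k \<omega>})"
  have E: "E k \<in> sets M\<^sub>0" for k unfolding E_def by measurable
  define T where "T = (\<lambda>n. {k. b k = n \<and> k \<in> I})"
  define S where "S = (\<lambda>n. {k. k \<le> i \<and> b k = n \<and> C_ind b P lam k \<omega> = 0})"
  define p where "p = (\<lambda>j. cond_prob_past M\<^sub>0 P lev {k\<in>T (b j). k < j} j \<omega>)"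
  have C: "C_ind b P lam j \<omega> = 0 \<or> C_ind b P lam j \<omega> = 1" for j
    unfolding C_ind_def by simp
  \<comment> \<open>Within a batch the divisor is constant, and the 0/1 factor merely selects the
    indices with \<open>C = 0\<close>.\<close>
  have restr: "(\<Sum>j\<in>{j\<in>J. b j = n}. f j / (1 - lam (b j) \<omega>) * (1 - C_ind b P lam j \<omega>))
      = (\<Sum>j\<in>{j\<in>J. b j = n \<and> C_ind b P lam j \<omega> = 0}. f j) / (1 - lam n \<omega>)"
    if "finite J" for f J n
    unfolding sum_divide_distrib using that C
    by (intro sum.mono_neutral_cong_right) auto
  have group: "(\<Sum>n\<in>b ` {..i}. \<Sum>j\<in>{j\<in>J. b j = n}. f j) = (\<Sum>j\<in>J. f j)"
    if "J \<subseteq> {..i}" for f :: "nat \<Rightarrow> real" and J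
    using that by (intro sum.group) (auto intro: finite_subset)
  have "(\<Sum>j\<in>{j\<in>{j. j \<le> i \<and> j \<in> I}. b j = n}. p j / (1 - lam (b j) \<omega>) * (1 - C_ind b P lam j \<omega>))
      \<le> (\<Sum>j\<in>{j\<in>{..i}. b j = n}. alpha_c M\<^sub>0 b P lam lev j \<omega> / (1 - lam (b j) \<omega>)
            * (1 - C_ind b P lam j \<omega>))" if n: "n \<in> b ` {..i}" for n
  proof -
    have "(\<Sum>j\<in>S n \<inter> T n. p j) = (\<Sum>j\<in>S n \<inter> T n. measure M\<^sub>0 (E j - (\<Union>k\<in>{k\<in>T n. k < j}. E k)))"
    proof (rule sum.cong[OF refl])
      fix j assume "j \<in> S n \<inter> T n"
      then have "b j = n" unfolding T_def by auto
      then show "p j = measure M\<^sub>0 (E j - (\<Union>k\<in>{k\<in>T n. k < j}. E k))"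
        unfolding p_def E_def by (simp only: cond_prob_past_eq_measure_first)
    qed
    also have "\<dots> \<le> (\<Sum>j\<in>S n. measure M\<^sub>0 (E j - (\<Union>k\<in>{k\<in>S n. k < j}. E k)))"
      using E by (intro sum_measure_first_mono) (auto simp: S_def)
    also have "\<dots> = (\<Sum>j\<in>S n. alpha_c M\<^sub>0 b P lam lev j \<omega>)"
    proof (rule sum.cong[OF refl])
      fix j assume "j \<in> S n"
      \<comment> \<open>The truncation of \<open>S n\<close> at \<open>i\<close> loses nothing,
        because \<open>k < j\<close> and \<open>j \<le> i\<close>.\<close>
      then have "{k. b k = b j \<and> k < j \<and> C_ind b P lam k \<omega> = 0} = {k\<in>S n. k < j}"
        unfolding S_def by auto
      then show "measure M\<^sub>0 (E j - (\<Union>k\<in>{k\<in>S n. k < j}. E k)) = alpha_c M\<^sub>0 b P lam lev j \<omega>"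
        unfolding alpha_c_def by (simp only: cond_prob_past_eq_measure_first E_def)
    qed
    finally have "(\<Sum>j\<in>S n \<inter> T n. p j) / (1 - lam n \<omega>)
        \<le> (\<Sum>j\<in>S n. alpha_c M\<^sub>0 b P lam lev j \<omega>) / (1 - lam n \<omega>)"
      using lam n by (intro divide_right_mono) (auto simp: less_imp_le)
    moreover have "{j\<in>{j. j \<le> i \<and> j \<in> I}. b j = n \<and> C_ind b P lam j \<omega> = 0} = S n \<inter> T n"
      "{j\<in>{..i}. b j = n \<and> C_ind b P lam j \<omega> = 0} = S n"
      unfolding S_def T_def by auto
    moreover have "finite {j. j \<le> i \<and> j \<in> I}" by simp
    ultimately show ?thesis by (simp only: restr finite_atMost)
  qed
  then have "(\<Sum>n\<in>b ` {..i}. \<Sum>j\<in>{j\<in>{j. j \<le> i \<and> j \<in> I}. b j = n}.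
        p j / (1 - lam (b j) \<omega>) * (1 - C_ind b P lam j \<omega>))
      \<le> (\<Sum>n\<in>b ` {..i}. \<Sum>j\<in>{j\<in>{..i}. b j = n}. alpha_c M\<^sub>0 b P lam lev j \<omega> / (1 - lam (b j) \<omega>)
            * (1 - C_ind b P lam j \<omega>))" by (rule sum_mono)
  moreover have "{j. j \<le> i \<and> j \<in> I} \<subseteq> {..i}" by auto
  ultimately show ?thesis by (simp only: group order_refl p_def T_def)
qed

section \<open>The expected contribution of a single hypothesis\<close>

lemma cond_prob_past_measurable:
  assumes M: "prob_space M" and P: "\<And>i. P i \<in> borel_measurable M"
    and lev: "\<And>i. lev i \<in> borel_measurable (past M b P (b i))"
    and K: "K \<subseteq> b -` {b j}"
  shows "cond_prob_past M P lev K j \<in> borel_measurable (past M b P (b j))"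
proof -
  interpret prob_space M by fact
  let ?F = "past M b P (b j)"
  have lev': "lev k \<in> borel_measurable ?F" if "k \<in> insert j K" for k
    using lev[of k] that K by auto
  define D where "D = {z \<in> space (?F \<Otimes>\<^sub>M M).
    (\<forall>k\<in>K. lev k (fst z) < P k (snd z)) \<and> P j (snd z) \<le> lev j (fst z)}"
  have 1: "(\<lambda>z. lev k (fst z)) \<in> borel_measurable (?F \<Otimes>\<^sub>M M)" if "k \<in> insert j K" for k
    by (rule measurable_compose[OF measurable_fst lev'[OF that]])
  have 2: "(\<lambda>z. P k (snd z)) \<in> borel_measurable (?F \<Otimes>\<^sub>M M)" for k
    by (rule measurable_compose[OF measurable_snd P])
  have less: "Measurable.pred (?F \<Otimes>\<^sub>M M) (\<lambda>z. lev k (fst z) < P k (snd z))" if "k \<in> K" for k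
    using 1[OF insertI2[OF that]] 2[of k] by measurable
  have le: "Measurable.pred (?F \<Otimes>\<^sub>M M) (\<lambda>z. P j (snd z) \<le> lev j (fst z))"
    using 1[OF insertI1] 2[of j] by measurable
  have "Measurable.pred (?F \<Otimes>\<^sub>M M)
      (\<lambda>z. (\<forall>k\<in>K. lev k (fst z) < P k (snd z)) \<and> P j (snd z) \<le> lev j (fst z))"
    using less le by (intro pred_intros_logic pred_intros_countable_bounded countableI_type) auto
  then have D: "D \<in> sets (?F \<Otimes>\<^sub>M M)" unfolding D_def by (rule predE)
  have "(\<lambda>\<omega>. measure M (Pair \<omega> -` D)) \<in> borel_measurable ?F"
    unfolding measure_def by (intro borel_measurable_enn2real measurable_emeasure_Pair D)
  moreover have "measure M (Pair \<omega> -` D) = cond_prob_past M P lev K j \<omega>" if "\<omega> \<in> space ?F" for \<omega>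
    unfolding cond_prob_past_def using that
    by (intro arg_cong[where f="measure M"]) (auto simp: D_def space_pair_measure)
  ultimately show ?thesis by (rule measurable_cong[THEN iffD1, rotated])
qed

text \<open>Write \<open>p\<close> for the conditional probability, \<open>f\<close> for
  \<open>p\<close> divided by \<open>1 - \<lambda>\<close>, and \<open>g\<close> for
  \<open>1 - C\<close>. Given the past, \<open>g\<close> has mean at least
  \<open>1 - \<lambda>\<close> by validity of the p-value, so \<open>p\<close> is at most
  \<open>f\<close> times that mean. Integrating gives the bound.\<close>

lemma measure_first_le_integral:
  assumes M: "prob_space M" and P: "\<And>i. P i \<in> borel_measurable M"
    and ind: "batchwise_independent M b P"
    and lam: "\<And>i. lam (b i) \<in> borel_measurable (past M b P (b i))"
    and lam_range: "\<And>\<omega>. \<omega> \<in> space M \<Longrightarrow> lam (b j) \<omega> \<in> {0..<1}"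
    and lev: "\<And>i. lev i \<in> borel_measurable (past M b P (b i))"
    and valid: "\<And>x. x \<in> {0..1} \<Longrightarrow> measure M {\<omega> \<in> space M. P j \<omega> \<le> x} \<le> x"
    and K: "K \<subseteq> b -` {b j}"
    and bounded: "AE \<omega> in M. cond_prob_past M P lev K j \<omega> / (1 - lam (b j) \<omega>)
            * (1 - C_ind b P lam j \<omega>) \<le> \<alpha>"
  shows "integrable M (\<lambda>\<omega>. cond_prob_past M P lev K j \<omega> / (1 - lam (b j) \<omega>)
            * (1 - C_ind b P lam j \<omega>))"
    and "measure M {\<omega> \<in> space M. (\<forall>k\<in>K. lev k \<omega> < P k \<omega>) \<and> P j \<omega> \<le> lev j \<omega>}
      \<le> (\<integral>\<omega>. cond_prob_past M P lev K j \<omega> / (1 - lam (b j) \<omega>) * (1 - C_ind b P lam j \<omega>) \<partial>M)"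
proof -
  interpret prob_space M by fact
  define F where "F = past M b P (b j)"
  define p where "p = cond_prob_past M P lev K j"
  define f where "f = (\<lambda>\<omega>. p \<omega> / (1 - lam (b j) \<omega>))"
  define N where "N = {\<omega> \<in> space M. P j \<omega> \<le> lam (b j) \<omega>}"
  define g :: "'a \<Rightarrow> real" where "g = (\<lambda>\<omega>. 1 - indicator N \<omega>)"
  define A where "A = {\<omega> \<in> space M. (\<forall>k\<in>K. lev k \<omega> < P k \<omega>) \<and> P j \<omega> \<le> lev j \<omega>}"
  have sub: "subalgebra M F" unfolding F_def by (rule subalgebra_past[OF P])
  interpret sigma_finite_subalgebra M F
    using sub by (intro finite_measure_subalgebra_is_sigma_finite)
       (simp add: finite_measure_subalgebra_def finite_measure_subalgebra_axioms_def finite_measure_axioms)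
  have lamF: "lam (b j) \<in> borel_measurable F" unfolding F_def by (rule lam)
  have pF: "p \<in> borel_measurable F"
    unfolding p_def F_def by (rule cond_prob_past_measurable[OF M P lev K])
  have fF: "f \<in> borel_measurable F" unfolding f_def using pF lamF by measurable
  have lamM[measurable]: "lam (b j) \<in> borel_measurable M"
    by (rule measurable_from_subalg[OF sub lamF])
  have pM[measurable]: "p \<in> borel_measurable M" by (rule measurable_from_subalg[OF sub pF])
  have fM[measurable]: "f \<in> borel_measurable M" by (rule measurable_from_subalg[OF sub fF])
  note P[measurable]
  have N[measurable]: "N \<in> sets M" unfolding N_def by measurable
  have gM[measurable]: "g \<in> borel_measurable M" unfolding g_def by measurable
  have levM[measurable]: "lev k \<in> borel_measurable M" for k
    by (rule measurable_from_subalg[OF subalgebra_past[OF P] lev])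
  have A[measurable]: "A \<in> sets M"
    unfolding A_def by measurable
  have eq: "cond_prob_past M P lev K j \<omega> / (1 - lam (b j) \<omega>) * (1 - C_ind b P lam j \<omega>) = f \<omega> * g \<omega>"
    if "\<omega> \<in> space M" for \<omega>
    using that by (simp add: f_def g_def p_def N_def C_ind_def indicator_def)
  have p01: "0 \<le> p \<omega>" "p \<omega> \<le> 1" for \<omega>
    by (simp_all add: p_def cond_prob_past_nonneg) (simp add: cond_prob_past_def)
  have f0: "0 \<le> f \<omega>" if "\<omega> \<in> space M" for \<omega>
    using p01 lam_range[OF that] by (simp add: f_def)
  \<comment> \<open>\<open>f\<close> alone may be unbounded, since \<open>lam\<close> can come
    arbitrarily close to 1. The assumed bound on the product supplies integrability.\<close>
  have fg: "integrable M (\<lambda>\<omega>. f \<omega> * g \<omega>)"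
  proof (rule integrable_const_bound[where B="\<alpha>"])
    show "AE \<omega> in M. norm (f \<omega> * g \<omega>) \<le> \<alpha>"
      using bounded
    proof (rule AE_mp, intro AE_I2 impI)
      fix \<omega> assume \<omega>: "\<omega> \<in> space M"
        and "cond_prob_past M P lev K j \<omega> / (1 - lam (b j) \<omega>) * (1 - C_ind b P lam j \<omega>) \<le> \<alpha>"
      then have "f \<omega> * g \<omega> \<le> \<alpha>" by (simp only: eq[OF \<omega>])
      moreover have "0 \<le> f \<omega> * g \<omega>" using f0[OF \<omega>] by (simp add: g_def indicator_def)
      ultimately show "norm (f \<omega> * g \<omega>) \<le> \<alpha>" by simp
    qed
  qed measurable
  then show "integrable M (\<lambda>\<omega>. cond_prob_past M P lev K j \<omega> / (1 - lam (b j) \<omega>)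
            * (1 - C_ind b P lam j \<omega>))"
    by (subst Bochner_Integration.integrable_cong[OF refl eq])
  have pint: "integrable M p" by (rule integrable_const_bound[where B=1]) (use p01 in auto)
  have iN: "integrable M (indicator N :: _ \<Rightarrow> real)" and iA: "integrable M (indicator A :: _ \<Rightarrow> real)"
    by (simp_all add: emeasure_eq_measure)
  \<comment> \<open>The event \<open>C = 1\<close> has the same form as a rejection event, with
    \<open>lam\<close> in the role of the levels and no excluded indices. Its frozen threshold is a
    number in the unit interval, to which validity applies.\<close>
  have "AE \<omega> in M. real_cond_exp M F (indicator N) \<omega> = cond_prob_past M P (\<lambda>i. lam (b i)) {} j \<omega>"
    using cond_prob_past_eq_real_cond_exp[OF M P ind, of "\<lambda>i. lam (b i)" "{}" j] lam
    unfolding N_def F_def by simp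
  then have N_le: "AE \<omega> in M. real_cond_exp M F (indicator N) \<omega> \<le> lam (b j) \<omega>"
  proof (rule AE_mp, intro AE_I2 impI)
    fix \<omega> assume "\<omega> \<in> space M"
      and "real_cond_exp M F (indicator N) \<omega> = cond_prob_past M P (\<lambda>i. lam (b i)) {} j \<omega>"
    then show "real_cond_exp M F (indicator N) \<omega> \<le> lam (b j) \<omega>"
      using valid[of "lam (b j) \<omega>"] lam_range[of \<omega>] by (simp add: cond_prob_past_def)
  qed
  have one: "AE \<omega> in M. real_cond_exp M F (\<lambda>_. 1) \<omega> = 1"
    by (rule real_cond_exp_F_meas) auto
  have "AE \<omega> in M. real_cond_exp M F g \<omega> =
      real_cond_exp M F (\<lambda>_. 1) \<omega> - real_cond_exp M F (indicator N) \<omega>"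
    unfolding g_def by (rule real_cond_exp_diff) (use iN in auto)
  then have p_le: "AE \<omega> in M. p \<omega> \<le> f \<omega> * real_cond_exp M F g \<omega>"
    using N_le one AE_space
  proof eventually_elim
    case (elim \<omega>)
    then have "p \<omega> = f \<omega> * (1 - lam (b j) \<omega>)"
      using lam_range[of \<omega>] by (simp add: f_def)
    also have "\<dots> \<le> f \<omega> * real_cond_exp M F g \<omega>"
      using elim f0 by (intro mult_left_mono) auto
    finally show ?case .
  qed
  have "AE \<omega> in M. real_cond_exp M F (indicator A) \<omega> = p \<omega>"
    using cond_prob_past_eq_real_cond_exp[OF M P ind lev K] unfolding A_def F_def p_def .
  then have "(\<integral>\<omega>. real_cond_exp M F (indicator A) \<omega> \<partial>M) = (\<integral>\<omega>. p \<omega> \<partial>M)"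
    by (intro integral_cong_AE) auto
  then have "measure M A = (\<integral>\<omega>. p \<omega> \<partial>M)"
    using real_cond_exp_int(2)[OF iA] by simp
  also have "\<dots> \<le> (\<integral>\<omega>. f \<omega> * real_cond_exp M F g \<omega> \<partial>M)"
    using pint real_cond_exp_intg(1)[OF fg fF gM] p_le by (rule integral_mono_AE)
  \<comment> \<open>The factor \<open>f\<close> is measurable with respect to the past, so it passes
    through the conditional expectation.\<close>
  also have "\<dots> = (\<integral>\<omega>. f \<omega> * g \<omega> \<partial>M)"
    by (rule real_cond_exp_intg(2)[OF fg fF gM])
  also have "\<dots> = (\<integral>\<omega>. cond_prob_past M P lev K j \<omega> / (1 - lam (b j) \<omega>) * (1 - C_ind b P lam j \<omega>) \<partial>M)"
    by (rule Bochner_Integration.integral_cong[OF refl eq, symmetric])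
  finally show "measure M {\<omega> \<in> space M. (\<forall>k\<in>K. lev k \<omega> < P k \<omega>) \<and> P j \<omega> \<le> lev j \<omega>}
      \<le> (\<integral>\<omega>. cond_prob_past M P lev K j \<omega> / (1 - lam (b j) \<omega>) * (1 - C_ind b P lam j \<omega>) \<partial>M)"
    unfolding A_def .
qed

section \<open>From the budget to familywise error control\<close>

lemma (in finite_measure) measure_UN_le_of_partial_sums:
  fixes A :: "nat \<Rightarrow> 'a set"
  assumes A: "\<And>j. A j \<in> sets M" and le: "\<And>n. (\<Sum>j<n. measure M (A j)) \<le> c"
  shows "measure M (\<Union>j. A j) \<le> c"
proof -
  have "(\<Sum>j\<le>n. measure M (A j)) \<le> c" for n
    using le[of "Suc n"] by (simp only: lessThan_Suc_atMost)
  then have s: "summable (\<lambda>j. measure M (A j))"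
    by (intro bounded_imp_summable[where B=c]) auto
  have "measure M (\<Union>j. A j) \<le> (\<Sum>j. measure M (A j))"
    using A s by (intro finite_measure_subadditive_countably) auto
  also have "\<dots> \<le> c" using s le by (rule suminf_le_const)
  finally show ?thesis .
qed

theorem theoremB1:
  fixes \<Omega> :: "'a measure" and \<P> :: "'a measure set" and H :: "nat \<Rightarrow> 'a measure set"
    and M\<^sub>0 :: "'a measure"
    and P lev lam :: "nat \<Rightarrow> 'a \<Rightarrow> real" and b :: "nat \<Rightarrow> nat" and \<alpha> :: real
  assumes alpha: "0 < \<alpha>" "\<alpha> < 1"
    and model: "statistical_model \<Omega> \<P>"
    and global_null: "M\<^sub>0 \<in> intersection_null \<P> H UNIV"
    and P_meas: "\<And>i. P i \<in> borel_measurable \<Omega>"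
    and P_range: "\<And>i \<omega>. \<omega> \<in> space \<Omega> \<Longrightarrow> P i \<omega> \<in> {0..1}"
    and valid: "valid_null_pvalues \<P> H P"
    and pivotality: "subset_pivotality \<P> H P"
    and batches: "batching b"
    and indep: "\<And>M. M \<in> \<P> \<Longrightarrow> batchwise_independent M b P"
    and lam_meas: "\<And>i. lam (b i) \<in> borel_measurable (past \<Omega> b P (b i))"
    and lam_range: "\<And>i \<omega>. \<omega> \<in> space \<Omega> \<Longrightarrow> lam (b i) \<omega> \<in> {0..<1}"
    and lev_meas: "\<And>i. lev i \<in> borel_measurable (past \<Omega> b P (b i))"
    and lev_range: "\<And>i \<omega>. \<omega> \<in> space \<Omega> \<Longrightarrow> lev i \<omega> \<in> {0..<1}"
    and budget: "\<And>M. M \<in> \<P> \<Longrightarrow>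
      AE \<omega> in M. \<forall>i. (\<Sum>j\<le>i. alpha_c M\<^sub>0 b P lam lev j \<omega> / (1 - lam (b j) \<omega>)
                              * (1 - C_ind b P lam j \<omega>)) \<le> \<alpha>"
  shows "strong_fwer_control \<P> H P lev \<alpha>"
proof -
  have "fwer H P lev M \<le> \<alpha>" if MP: "M \<in> \<P>" for M
  proof -
    have M: "prob_space M" and setsM: "sets M = sets \<Omega>"
      using model MP unfolding statistical_model_def by auto
    have spM: "space M = space \<Omega>" using setsM by (rule sets_eq_imp_space_eq)
    have M0P: "M\<^sub>0 \<in> \<P>" using global_null unfolding intersection_null_def by auto
    have M0: "prob_space M\<^sub>0" and setsM0: "sets M\<^sub>0 = sets \<Omega>"
      using model M0P unfolding statistical_model_def by auto
    interpret prob_space M by fact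
    have P: "P i \<in> borel_measurable M" for i
      using P_meas by (simp add: measurable_cong_sets[OF setsM refl])
    have P0: "P i \<in> borel_measurable M\<^sub>0" for i
      using P_meas by (simp add: measurable_cong_sets[OF setsM0 refl])
    have past: "past M b P n = past \<Omega> b P n" for n unfolding past_def spM ..
    define I where "I = true_nulls H M"
    define K where "K = (\<lambda>j. {k\<in>{k. b k = b j \<and> k \<in> I}. k < j})"
    define X where "X = (\<lambda>j \<omega>. cond_prob_past M P lev (K j) j \<omega> / (1 - lam (b j) \<omega>)
          * (1 - C_ind b P lam j \<omega>))"
    \<comment> \<open>Only earlier false rejections of the same batch are excluded, because
      \<open>cond_prob_past\<close> redraws one batch. Events of different batches may thus overlap,
      and they are combined by subadditivity.\<close>
    define A where "A = (\<lambda>j. if j \<in> I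
      then {\<omega> \<in> space M. (\<forall>k\<in>K j. lev k \<omega> < P k \<omega>) \<and> P j \<omega> \<le> lev j \<omega>} else {})"
    have "M \<in> intersection_null \<P> H I"
      using MP unfolding intersection_null_def I_def true_nulls_def by auto
    then have law: "pvalue_law M\<^sub>0 P I = pvalue_law M P I"
      using pivotality global_null unfolding subset_pivotality_def by metis
    have pivot: "cond_prob_past M\<^sub>0 P lev (K j) j \<omega> = cond_prob_past M P lev (K j) j \<omega>"
      if "j \<in> I" for j \<omega>
      using that by (intro pvalue_law_eq_imp_cond_prob_past_eq[OF law P0 P]) (auto simp: K_def)
    have X0: "0 \<le> X j \<omega>" if "\<omega> \<in> space M" for j \<omega>
      using lam_range[of \<omega> j] that
      by (auto simp: X_def spM C_ind_def intro!: mult_nonneg_nonneg divide_nonneg_nonneg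
          cond_prob_past_nonneg)
    \<comment> \<open>The budget holds almost surely under the true \<open>M\<close> but involves
      probabilities under \<open>M\<^sub>0\<close>. The comparison with the true nulls is made under
      \<open>M\<^sub>0\<close> first, and \<open>pivot\<close> then replaces
      \<open>M\<^sub>0\<close> by \<open>M\<close>.\<close>
    have X_sum: "AE \<omega> in M. (\<Sum>j\<in>{j. j \<le> i \<and> j \<in> I}. X j \<omega>) \<le> \<alpha>" for i
      using budget[OF MP] AE_space
    proof eventually_elim
      case (elim \<omega>)
      have "(\<Sum>j\<in>{j. j \<le> i \<and> j \<in> I}. X j \<omega>) = (\<Sum>j\<in>{j. j \<le> i \<and> j \<in> I}.
          cond_prob_past M\<^sub>0 P lev (K j) j \<omega> / (1 - lam (b j) \<omega>) * (1 - C_ind b P lam j \<omega>))"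
        by (rule sum.cong) (auto simp: X_def pivot)
      also have "\<dots> \<le> (\<Sum>j\<le>i. alpha_c M\<^sub>0 b P lam lev j \<omega> / (1 - lam (b j) \<omega>)
          * (1 - C_ind b P lam j \<omega>))"
        unfolding K_def using lam_range elim(2)
        by (intro sum_cond_prob_past_le_sum_alpha_c[OF M0 P0]) (auto simp: spM)
      finally show ?case using elim(1) by (meson order_trans)
    qed
    \<comment> \<open>All terms are nonnegative, so each is at most a partial sum. This is the bound
      that \<open>measure_first_le_integral\<close> requires.\<close>
    have X_le: "AE \<omega> in M. X j \<omega> \<le> \<alpha>" if "j \<in> I" for j
      using X_sum[of j] AE_space
    proof eventually_elim
      case (elim \<omega>)
      have "X j \<omega> \<le> (\<Sum>j\<in>{i. i \<le> j \<and> i \<in> I}. X j \<omega>)"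
        using that X0[OF elim(2)] by (intro member_le_sum) auto
      with elim(1) show ?case by linarith
    qed
    have step: "integrable M (X j)" "measure M (A j) \<le> (\<integral>\<omega>. X j \<omega> \<partial>M)" if j: "j \<in> I" for j
    proof -
      have v: "measure M {\<omega> \<in> space M. P j \<omega> \<le> x} \<le> x" if "x \<in> {0..1}" for x
        using valid MP j that unfolding valid_null_pvalues_def I_def by blast
      have K: "K j \<subseteq> b -` {b j}" unfolding K_def by auto
      note l = measure_first_le_integral[where lam=lam, OF M P indep[OF MP] _ _ _ v K
          X_le[OF j, unfolded X_def], unfolded past spM, OF lam_meas lam_range lev_meas]
      show "integrable M (X j)" "measure M (A j) \<le> (\<integral>\<omega>. X j \<omega> \<partial>M)"
        using l j by (simp_all add: X_def A_def spM)
    qed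
    have lev: "lev k \<in> borel_measurable M" for k
      using lev_meas[of k]
      by (intro measurable_from_subalg[OF subalgebra_past[where P=P and b=b and n="b k", OF P]])
        (simp only: past)
    note P[measurable] lev[measurable]
    have A: "A j \<in> sets M" for j
      by (cases "j \<in> I") (simp_all add: A_def)
    have "(\<Sum>j<n. measure M (A j)) \<le> \<alpha>" for n
    proof -
      let ?J = "{j. j \<le> n \<and> j \<in> I}"
      \<comment> \<open>One more term is added because the budget is stated for sums up to and
        including an index.\<close>
      have "(\<Sum>j<n. measure M (A j)) \<le> (\<Sum>j\<le>n. measure M (A j))"
        by (rule sum_mono2) auto
      also have "\<dots> = (\<Sum>j\<in>?J. measure M (A j))"
        by (rule sum.mono_neutral_right) (auto simp: A_def)
      also have "\<dots> \<le> (\<Sum>j\<in>?J. \<integral>\<omega>. X j \<omega> \<partial>M)"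
        using step(2) by (intro sum_mono) auto
      also have "\<dots> = (\<integral>\<omega>. (\<Sum>j\<in>?J. X j \<omega>) \<partial>M)"
        using step(1) by (intro Bochner_Integration.integral_sum[symmetric]) auto
      \<comment> \<open>The whole sum is below \<open>\<alpha>\<close> almost surely, hence so is
        its mean under a probability measure.\<close>
      also have "\<dots> \<le> \<alpha>"
        using step(1) X_sum[of n]
        by (intro integral_le_const Bochner_Integration.integrable_sum) auto
      finally show ?thesis .
    qed
    with A have UN: "measure M (\<Union>j. A j) \<le> \<alpha>" by (rule measure_UN_le_of_partial_sums)
    have "{\<omega> \<in> space M. \<exists>i\<in>I. P i \<omega> \<le> lev i \<omega>} \<subseteq> (\<Union>j. A j)"
    proof -
      let ?E = "\<lambda>j. {\<omega> \<in> space M. P j \<omega> \<le> lev j \<omega>}"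
      \<comment> \<open>Any outcome with a false rejection has a first one over all batches. It is
        also the first in its own batch, so the outcome lies in some \<open>A j\<close>.\<close>
      have "{\<omega> \<in> space M. \<exists>i\<in>I. P i \<omega> \<le> lev i \<omega>} = (\<Union>j\<in>I. ?E j)" by auto
      also have "\<dots> = (\<Union>j\<in>I. ?E j - (\<Union>k\<in>{k\<in>I. k < j}. ?E k))"
        by (simp only: UN_first_eq)
      also have "\<dots> \<subseteq> (\<Union>j\<in>I. A j)"
        by (rule UN_mono) (auto simp: A_def K_def not_le)
      finally show ?thesis by blast
    qed
    then have "measure M {\<omega> \<in> space M. \<exists>i\<in>I. P i \<omega> \<le> lev i \<omega>} \<le> measure M (\<Union>j. A j)"
      using A by (intro finite_measure_mono) auto
    with UN show ?thesis unfolding fwer_def I_def by linarith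
  qed
  then show ?thesis unfolding strong_fwer_control_def by blast
qed

end
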